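(* Let $H$ be a dephased complex Hadamard matrix of order $n$ with columns $\mathbf{h}_1=\mathbf{1},\mathbf{h}_2,\dots,\mathbf{h}_n$, and let $G$ be an unweighted simple graph on $n$ vertices that is diagonalisable by $H$, with $L(G)\mathbf{h}_j=\lambda_j\mathbf{h}_j$ for $j=1,\dots,n$. Let $d$ be the common degree of the vertices of $G$. Then for each $k>1$ such that all entries of $\mathbf{h}_k$ lie in $\{1,-1,\mathrm{i},-\mathrm{i}\}$, the graph $G$ has an equitable partition into two cells, each having exactly $\frac n2$ vertices, with quotient matrix $$\begin{bmatrix} d-\frac{\lambda_k}{2} & \frac{\lambda_k}{2}\\ \frac{\lambda_k}{2} & d-\frac{\lambda_k}{2}\end{bmatrix}.$$ Moreover, $\lambda_k$ is an even integer.
   Context: A complex Hadamard matrix of order $n$ is an $n\times n$ complex matrix $H$ whose entries all have modulus one and which satisfies $HH^*=nI$. It is dephased if its first row and first column are all-ones vectors. $L(G)=D(G)-A(G)$ is the Laplacian matrix (degree matrix minus adjacency matrix). $G$ is diagonalisable by $H$ if every column of $H$ is an eigenvector of $L(G)$ (equivalently $\frac1n H^*L(G)H$ is diagonal); such a graph is necessarily regular. $\mathbf 1$ is the all-ones vector. A partition $V(G)=V_1\cup\dots\cup V_m$ is equitable if for all $i,j$ there is a constant $v_{i,j}$ such that every vertex in $V_i$ has exactly $v_{i,j}$ neighbours in $V_j$; its quotient matrix is $[v_{i,j}]$. *)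

theory Defs
  imports
    "Jordan_Normal_Form.Char_Poly"
    "Jordan_Normal_Form.Schur_Decomposition"
    "Graph_Theory.Pair_Digraph"
    "HOL-Library.Disjoint_Sets"
    Complex_Main
begin

text \<open>
  Undirected simple graphs are the \<^locale>\<open>pair_graph\<close>s of Graph-Theory: finite, loopless, with a
  symmetric set of pairs as arcs, so that the degree of a vertex is its out-degree.
  A graph whose matrices are considered has vertex set \<open>{0..<n}\<close>, and vertex \<open>i\<close> labels
  row and column \<open>i\<close>; thus all indices are shifted down by one from \<open>1,\<dots>,n\<close>.
\<close>

definition complex_hadamard :: "nat \<Rightarrow> complex mat \<Rightarrow> bool" where
  "complex_hadamard n H \<longleftrightarrow>
     H \<in> carrier_mat n n \<and>
     (\<forall>i<n. \<forall>j<n. cmod (H $$ (i, j)) = 1) \<and>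
     H * mat_adjoint H = of_nat n \<cdot>\<^sub>m 1\<^sub>m n"

definition dephased :: "complex mat \<Rightarrow> bool" where
  "dephased H \<longleftrightarrow>
     (\<forall>j<dim_col H. H $$ (0, j) = 1) \<and> (\<forall>i<dim_row H. H $$ (i, 0) = 1)"

definition degree_matrix :: "nat pair_pre_digraph \<Rightarrow> complex mat" where
  "degree_matrix G = (let n = card (pverts G) in
     mat n n (\<lambda>(i, j). if i = j then of_nat (out_degree (with_proj G) i) else 0))"

definition adjacency_matrix :: "nat pair_pre_digraph \<Rightarrow> complex mat" where
  "adjacency_matrix G = (let n = card (pverts G) in
     mat n n (\<lambda>(i, j). if (i, j) \<in> parcs G then 1 else 0))"

definition laplacian :: "nat pair_pre_digraph \<Rightarrow> complex mat" where
  "laplacian G = degree_matrix G - adjacency_matrix G"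

definition diagonalisable_by :: "nat pair_pre_digraph \<Rightarrow> complex mat \<Rightarrow> bool" where
  "diagonalisable_by G H \<longleftrightarrow>
     (\<forall>j<dim_col H. \<exists>c. eigenvector (laplacian G) (col H j) c)"

definition nbrs_in :: "'a pair_pre_digraph \<Rightarrow> 'a \<Rightarrow> 'a set \<Rightarrow> nat" where
  "nbrs_in G x W = card {y \<in> W. (x, y) \<in> parcs G}"

text \<open>The cells of a partition are listed in order; by \<^const>\<open>partition_on\<close> they are nonempty.\<close>

definition equitable_partition :: "'a pair_pre_digraph \<Rightarrow> 'a set list \<Rightarrow> bool" where
  "equitable_partition G Vs \<longleftrightarrow>
     distinct Vs \<and> partition_on (pverts G) (set Vs) \<and>
     (\<forall>i<length Vs. \<forall>j<length Vs. \<exists>v. \<forall>x\<in>Vs ! i. nbrs_in G x (Vs ! j) = v)"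

text \<open>Meaningful for equitable partitions only, where the described constant exists and is unique.\<close>

definition quotient_matrix :: "'a pair_pre_digraph \<Rightarrow> 'a set list \<Rightarrow> nat mat" where
  "quotient_matrix G Vs =
     mat (length Vs) (length Vs) (\<lambda>(i, j). THE v. \<forall>x\<in>Vs ! i. nbrs_in G x (Vs ! j) = v)"

end

theory Submission
  imports Defs
begin

text \<open>
  Every diagonal entry of \<open>L = H \<Lambda> H\<^sup>* / n\<close> is the mean of the eigenvalues, as all entries of
  \<open>H\<close> have modulus one; hence \<open>G\<close> is regular. Since \<open>L\<close> is real symmetric, the real and imaginary
  parts of \<open>h\<^sub>k\<close> satisfy the same eigenvector equation as \<open>h\<^sub>k\<close>. Their sum \<open>z\<close> has all its entries
  in \<open>{1, -1}\<close>, and its entries add up to \<open>0\<close> because \<open>h\<^sub>k\<close> is orthogonal to \<open>h\<^sub>1\<close>. The cells are the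
  two level sets of \<open>z\<close>: at a vertex with \<open>b\<close> neighbours in the opposite cell the eigenvector
  equation reads \<open>d - ((d - b) - b) = \<lambda>\<^sub>k\<close>, that is \<open>\<lambda>\<^sub>k = 2 b\<close>.
\<close>

section \<open>Orthogonality of the rows and columns of a Hadamard matrix\<close>

lemma complex_hadamard_row_inner:
  assumes "complex_hadamard n H" "i < n" "k < n"
  shows "(\<Sum>j<n. H $$ (i, j) * cnj (H $$ (k, j))) = (if i = k then of_nat n else 0)"
proof -
  have H: "H \<in> carrier_mat n n" and HH: "H * mat_adjoint H = of_nat n \<cdot>\<^sub>m 1\<^sub>m n"
    using assms(1) by (auto simp: complex_hadamard_def)
  have "(H * mat_adjoint H) $$ (i, k) = (\<Sum>j<n. H $$ (i, j) * cnj (H $$ (k, j)))"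
    using H assms(2,3)
    by (simp add: mat_adjoint_def mat_of_rows_def scalar_prod_def atLeast0LessThan)
  then show ?thesis
    unfolding HH using assms(2,3) by (auto split: if_splits)
qed

text \<open>A one-sided inverse of a square matrix is two-sided, so \<open>mat_adjoint H\<close>
  divided by \<open>n\<close> is also a left inverse of \<open>H\<close>; this carries orthogonality
  from rows to columns.\<close>

lemma complex_hadamard_col_inner:
  assumes "complex_hadamard n H" "i < n" "k < n"
  shows "(\<Sum>j<n. cnj (H $$ (j, i)) * H $$ (j, k)) = (if i = k then of_nat n else 0)"
proof -
  have H: "H \<in> carrier_mat n n" and HH: "H * mat_adjoint H = of_nat n \<cdot>\<^sub>m 1\<^sub>m n"
    using assms(1) by (auto simp: complex_hadamard_def)
  have A: "mat_adjoint H \<in> carrier_mat n n"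
    using H by (auto simp: mat_adjoint_def)
  let ?B = "inverse (of_nat n) \<cdot>\<^sub>m mat_adjoint H"
  have B: "?B \<in> carrier_mat n n"
    using A by simp
  have HB: "H * ?B = 1\<^sub>m n"
    unfolding mult_smult_distrib[OF H A] HH using assms(2) by (intro eq_matI) auto
  note BH = mat_mult_left_right_inverse[OF H B HB]
  have "(?B * H) $$ (i, k) = inverse (of_nat n) * (\<Sum>j<n. cnj (H $$ (j, i)) * H $$ (j, k))"
    using H A assms(2,3)
    by (simp add: mat_adjoint_def mat_of_rows_def scalar_prod_def atLeast0LessThan
        sum_distrib_left mult.assoc)
  then have "inverse (of_nat n) * (\<Sum>j<n. cnj (H $$ (j, i)) * H $$ (j, k)) =
      (if i = k then 1 else 0)"
    unfolding BH using assms(2,3) by simp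
  then show ?thesis
    using assms(2) by (cases "i = k") (simp_all add: field_simps)
qed

section \<open>The Laplacian in coordinates, and regularity from its diagonal\<close>

lemma out_degree_eq_card:
  fixes G :: "'a pair_pre_digraph"
  shows "out_degree (with_proj G) v = card {u. (v, u) \<in> parcs G}"
proof -
  have "out_arcs (with_proj G) v = Pair v ` {u. (v, u) \<in> parcs G}"
    by (auto simp: out_arcs_def)
  then show ?thesis
    by (simp add: out_degree_def card_image inj_on_def)
qed

text \<open>Bridge from matrices to graphs: it turns the eigenvector equation into one equation per
  vertex, the form in which the graph lemmas below are stated.\<close>

lemma laplacian_mult_vec:
  assumes G: "pair_fin_digraph G" "pverts G = {0..<n}" and x: "x \<in> carrier_vec n" and i: "i < n"
  shows "(laplacian G *\<^sub>v x) $ i =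
    of_nat (out_degree (with_proj G) i) * x $ i - (\<Sum>u | (i, u) \<in> parcs G. x $ u)"
proof -
  interpret pair_fin_digraph G by (fact G(1))
  let ?D = "of_nat (out_degree (with_proj G) i) :: complex"
  have "{u. (i, u) \<in> parcs G} = {u \<in> {0..<n}. (i, u) \<in> parcs G}"
    using in_arcsD2 G(2) by auto
  then have N: "(\<Sum>u | (i, u) \<in> parcs G. x $ u) =
      (\<Sum>u = 0..<n. if (i, u) \<in> parcs G then x $ u else 0)"
    by (simp only: sum.inter_filter finite_atLeastLessThan)
  have "(laplacian G *\<^sub>v x) $ i =
      (\<Sum>u = 0..<n. ((if i = u then ?D else 0) - (if (i, u) \<in> parcs G then 1 else 0)) * x $ u)"
    using x i G(2)
    by (auto simp: laplacian_def degree_matrix_def adjacency_matrix_def scalar_prod_def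
        intro!: sum.cong)
  also have "\<dots> = (\<Sum>u = 0..<n. (if i = u then ?D * x $ u else 0)
      - (if (i, u) \<in> parcs G then x $ u else 0))"
    by (rule sum.cong) (auto simp: algebra_simps)
  also have "\<dots> = ?D * x $ i - (\<Sum>u | (i, u) \<in> parcs G. x $ u)"
    unfolding N sum_subtractf using i by simp
  finally show ?thesis .
qed

text \<open>Multiply \<open>A H = H \<Lambda>\<close> by the adjoint of \<open>H\<close> and compare
  diagonal entries: on one side every weight is a squared modulus equal to 1, on the other row
  orthogonality leaves a single term. The point is that the right-hand side is free of
  \<open>i\<close>.\<close>

lemma complex_hadamard_diag_entry:
  assumes "complex_hadamard n H" and A: "A \<in> carrier_mat n n"
    and eig: "\<forall>j<n. A *\<^sub>v col H j = lam j \<cdot>\<^sub>v col H j" and i: "i < n"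
  shows "of_nat n * A $$ (i, i) = (\<Sum>j<n. lam j)"
proof -
  have H: "H \<in> carrier_mat n n" and unit: "\<And>j. j < n \<Longrightarrow> cmod (H $$ (i, j)) = 1"
    using assms(1) i by (auto simp: complex_hadamard_def)
  have one: "H $$ (i, j) * cnj (H $$ (i, j)) = 1" if "j < n" for j
    using unit[OF that] by (simp flip: complex_norm_square)
  have row: "(\<Sum>k<n. A $$ (i, k) * H $$ (k, j)) = lam j * H $$ (i, j)" if "j < n" for j
  proof -
    have "(A *\<^sub>v col H j) $ i = (lam j \<cdot>\<^sub>v col H j) $ i"
      using eig that by simp
    then show ?thesis
      using A H i that by (simp add: scalar_prod_def atLeast0LessThan)
  qed
  have "(\<Sum>j<n. lam j) = (\<Sum>j<n. (lam j * H $$ (i, j)) * cnj (H $$ (i, j)))"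
    using one by (intro sum.cong) (auto simp: mult.assoc)
  also have "\<dots> = (\<Sum>j<n. \<Sum>k<n. A $$ (i, k) * (H $$ (k, j) * cnj (H $$ (i, j))))"
    by (intro sum.cong) (auto simp: row[symmetric] sum_distrib_right mult.assoc)
  also have "\<dots> = (\<Sum>k<n. A $$ (i, k) * (\<Sum>j<n. H $$ (k, j) * cnj (H $$ (i, j))))"
    by (subst sum.swap) (simp add: sum_distrib_left)
  also have "\<dots> = (\<Sum>k<n. if k = i then A $$ (i, k) * of_nat n else 0)"
    using complex_hadamard_row_inner[OF assms(1) _ i] by (intro sum.cong) auto
  also have "\<dots> = A $$ (i, i) * of_nat n"
    using i by simp
  finally show ?thesis
    by (simp add: mult.commute)
qed

lemma laplacian_carrier:
  assumes "pverts G = {0..<n}"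
  shows "laplacian G \<in> carrier_mat n n"
  using assms
  by (auto simp: laplacian_def degree_matrix_def adjacency_matrix_def Let_def
      intro!: minus_carrier_mat)

lemma complex_hadamard_diagonalises_imp_regular:
  assumes had: "complex_hadamard n H" and G: "pair_graph G" "pverts G = {0..<n}"
    and eig: "\<forall>j<n. laplacian G *\<^sub>v col H j = lam j \<cdot>\<^sub>v col H j"
  shows "\<exists>d. \<forall>v\<in>pverts G. out_degree (with_proj G) v = d"
proof -
  interpret pair_graph G by (fact G(1))
  have "out_degree (with_proj G) v = out_degree (with_proj G) 0" if v: "v < n" for v
  proof -
    have diag: "laplacian G $$ (i, i) = of_nat (out_degree (with_proj G) i)" if "i < n" for i
      using that G(2) no_loops'[of i i]
      by (auto simp: laplacian_def degree_matrix_def adjacency_matrix_def)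
    \<comment> \<open>Vertex 0 is the reference vertex; \<open>v < n\<close> ensures that it exists
      and that the factor \<open>n\<close> can be cancelled.\<close>
    have "of_nat n * laplacian G $$ (v, v) = of_nat n * laplacian G $$ (0, 0)"
      using v complex_hadamard_diag_entry[OF had laplacian_carrier[OF G(2)] eig] by simp
    then show ?thesis
      using v by (simp add: diag)
  qed
  then show ?thesis
    unfolding G(2) by (metis atLeastLessThan_iff)
qed

section \<open>Laplacian eigenvectors of a simple graph\<close>

context pair_graph
begin

text \<open>Rayleigh quotient: pairing the equation with the conjugate of \<open>h\<close> gives
  \<open>\<mu> * P = E - Q\<close>, where \<open>E\<close> and \<open>Q\<close> are the degree and
  adjacency forms and \<open>P\<close> is the squared norm. Here \<open>deg\<close> is any
  natural-valued weight, so that a constant degree can be inserted.\<close>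

lemma laplacian_eigenvalue_real:
  fixes h :: "'a \<Rightarrow> complex"
  assumes eig: "\<And>v. v \<in> pverts G \<Longrightarrow> of_nat (deg v) * h v - (\<Sum>u | (v, u) \<in> parcs G. h u) = \<mu> * h v"
    and "w \<in> pverts G" "h w \<noteq> 0"
  shows "\<mu> \<in> \<real>"
proof -
  define Q where "Q = (\<Sum>v\<in>pverts G. \<Sum>u\<in>pverts G. if (v, u) \<in> parcs G then cnj (h v) * h u else 0)"
  define P where "P = (\<Sum>v\<in>pverts G. (cmod (h v))\<^sup>2)"
  define E where "E = (\<Sum>v\<in>pverts G. real (deg v) * (cmod (h v))\<^sup>2)"
  have nbrs: "{u. (v, u) \<in> parcs G} = {u \<in> pverts G. (v, u) \<in> parcs G}" for v
    using in_arcsD2 by auto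
  have sym: "(v, u) \<in> parcs G \<longleftrightarrow> (u, v) \<in> parcs G" for u v
    using pair_sym_arcs by (auto simp: symmetric_def sym_def)
  \<comment> \<open>Conjugation exchanges the roles of \<open>u\<close> and \<open>v\<close>;
    symmetry of the arcs then makes \<open>Q\<close> its own conjugate.\<close>
  have "cnj Q = (\<Sum>v\<in>pverts G. \<Sum>u\<in>pverts G. if (u, v) \<in> parcs G then cnj (h u) * h v else 0)"
    unfolding Q_def cnj_sum by (intro sum.cong refl) (auto simp: sym mult.commute)
  also have "\<dots> = Q"
    unfolding Q_def by (rule sum.swap)
  finally have Q: "Q \<in> \<real>"
    by (simp add: Reals_cnj_iff)
  have sq: "cnj (h v) * h v = of_real ((cmod (h v))\<^sup>2)" for v
    by (simp only: complex_norm_square mult.commute)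
  have "\<mu> * of_real P = (\<Sum>v\<in>pverts G. cnj (h v) * (\<mu> * h v))"
    unfolding P_def of_real_sum sq[symmetric] by (simp add: sum_distrib_left mult_ac)
  also have "\<dots> = (\<Sum>v\<in>pverts G. of_nat (deg v) * (cnj (h v) * h v)
      - cnj (h v) * (\<Sum>u | (v, u) \<in> parcs G. h u))"
    by (intro sum.cong refl) (auto simp: eig[symmetric] algebra_simps)
  also have "\<dots> = of_real E - Q"
    unfolding sum_subtractf E_def Q_def sq nbrs
    by (simp add: sum.inter_filter pair_finite_verts sum_distrib_left if_distrib cong: if_cong)
  finally have eq: "\<mu> * of_real P = of_real E - Q" .
  have "P > 0"
    unfolding P_def using assms(2,3) pair_finite_verts by (intro sum_pos2[of _ w]) auto
  then have "\<mu> = (of_real E - Q) / of_real P"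
    by (simp add: eq[symmetric])
  then show ?thesis
    using Q by simp
qed

text \<open>The neighbours of \<open>v\<close> split into \<open>?S\<close>, which agree with
  \<open>v\<close> in sign, and \<open>?O\<close>, which do not; cancelling \<open>z v\<close>
  leaves two linear equations for their sizes. Measuring signs relative to \<open>z v\<close> lets
  one statement serve both cells.\<close>

lemma sign_eigenvector_nbrs:
  fixes z :: "'a \<Rightarrow> real"
  assumes deg: "out_degree (with_proj G) v = d" and v: "v \<in> pverts G"
    and z: "\<And>u. u \<in> pverts G \<Longrightarrow> z u = 1 \<or> z u = -1"
    and eig: "real d * z v - (\<Sum>u | (v, u) \<in> parcs G. z u) = \<mu> * z v"
  shows "real (nbrs_in G v {u \<in> pverts G. z u = z v}) = real d - \<mu> / 2"
    and "real (nbrs_in G v {u \<in> pverts G. z u = - z v}) = \<mu> / 2"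
proof -
  let ?S = "{u \<in> pverts G. z u = z v \<and> (v, u) \<in> parcs G}"
  let ?O = "{u \<in> pverts G. z u = - z v \<and> (v, u) \<in> parcs G}"
  have zv: "z v = 1 \<or> z v = -1" by (rule z[OF v])
  have fin: "finite ?S" "finite ?O" using pair_finite_verts by auto
  have disj: "?S \<inter> ?O = {}" using zv by auto
  have N: "{u. (v, u) \<in> parcs G} = ?S \<union> ?O"
    using z zv in_arcsD2 by fastforce
  have d: "d = card ?S + card ?O"
    using deg card_Un_disjoint[OF fin disj] unfolding out_degree_eq_card N by simp
  have "(\<Sum>u\<in>?S. z u) = card ?S * z v" "(\<Sum>u\<in>?O. z u) = - (card ?O * z v)"
    by simp_all
  then have "real d * z v - (card ?S * z v - card ?O * z v) = \<mu> * z v"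
    using eig unfolding N sum.union_disjoint[OF fin disj] by simp
  then have mu: "\<mu> = 2 * card ?O"
    using zv d by auto
  show "real (nbrs_in G v {u \<in> pverts G. z u = z v}) = real d - \<mu> / 2"
    and "real (nbrs_in G v {u \<in> pverts G. z u = - z v}) = \<mu> / 2"
    using mu d by (simp_all add: nbrs_in_def conj_assoc)
qed

text \<open>The neighbour counts depend only on the cell, and the zero sum of \<open>z\<close> makes
  the cells equal in size, hence both nonempty. The entries \<open>a\<close> and \<open>b\<close>
  are returned as natural numbers because the integrality of \<open>\<mu> / 2\<close> is read off
  from \<open>b\<close>.\<close>

lemma sign_eigenvector_equitable_partition:
  fixes z :: "'a \<Rightarrow> real"
  assumes deg: "\<And>v. v \<in> pverts G \<Longrightarrow> out_degree (with_proj G) v = d"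
    and z: "\<And>v. v \<in> pverts G \<Longrightarrow> z v = 1 \<or> z v = -1"
    and eig: "\<And>v. v \<in> pverts G \<Longrightarrow> real d * z v - (\<Sum>u | (v, u) \<in> parcs G. z u) = \<mu> * z v"
    and bal: "(\<Sum>v\<in>pverts G. z v) = 0" and ne: "pverts G \<noteq> {}"
  shows "\<exists>V\<^sub>1 V\<^sub>2 a b. equitable_partition G [V\<^sub>1, V\<^sub>2] \<and> 2 * card V\<^sub>1 = card (pverts G) \<and>
    2 * card V\<^sub>2 = card (pverts G) \<and>
    quotient_matrix G [V\<^sub>1, V\<^sub>2] = mat_of_rows_list 2 [[a, b], [b, a]] \<and>
    real a = real d - \<mu> / 2 \<and> real b = \<mu> / 2"
proof -
  define V\<^sub>1 where "V\<^sub>1 = {v \<in> pverts G. z v = 1}"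
  define V\<^sub>2 where "V\<^sub>2 = {v \<in> pverts G. z v = -1}"
  have V: "V\<^sub>1 \<union> V\<^sub>2 = pverts G" "V\<^sub>1 \<inter> V\<^sub>2 = {}"
    using z by (auto simp: V\<^sub>1_def V\<^sub>2_def)
  have fin: "finite V\<^sub>1" "finite V\<^sub>2"
    using pair_finite_verts by (auto simp: V\<^sub>1_def V\<^sub>2_def)
  have "(\<Sum>v\<in>V\<^sub>1. z v) + (\<Sum>v\<in>V\<^sub>2. z v) = 0"
    using bal sum.union_disjoint[OF fin V(2), of z] by (simp add: V(1))
  moreover have "(\<Sum>v\<in>V\<^sub>1. z v) = card V\<^sub>1" "(\<Sum>v\<in>V\<^sub>2. z v) = - card V\<^sub>2"
    by (simp_all add: V\<^sub>1_def V\<^sub>2_def)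
  ultimately have half: "card V\<^sub>1 = card V\<^sub>2"
    by simp
  have card: "card V\<^sub>1 + card V\<^sub>2 = card (pverts G)"
    using card_Un_disjoint[OF fin V(2)] by (simp add: V(1))
  have nonempty: "V\<^sub>1 \<noteq> {}" "V\<^sub>2 \<noteq> {}"
    using half card ne pair_finite_verts fin by auto
  note nbrs = sign_eigenvector_nbrs[OF deg _ z eig]
  have n1: "real (nbrs_in G v V\<^sub>1) = real d - \<mu> / 2" "real (nbrs_in G v V\<^sub>2) = \<mu> / 2"
    if "v \<in> V\<^sub>1" for v
    using that nbrs[of v] by (simp_all add: V\<^sub>1_def V\<^sub>2_def)
  have n2: "real (nbrs_in G v V\<^sub>1) = \<mu> / 2" "real (nbrs_in G v V\<^sub>2) = real d - \<mu> / 2"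
    if "v \<in> V\<^sub>2" for v
    using that nbrs[of v] by (simp_all add: V\<^sub>1_def V\<^sub>2_def)
  \<comment> \<open>The constants are read off at an arbitrary vertex of the first cell;
    \<open>n1\<close> and \<open>n2\<close> carry them to all other vertices.\<close>
  obtain w where w: "w \<in> V\<^sub>1" using nonempty by auto
  define a where "a = nbrs_in G w V\<^sub>1"
  define b where "b = nbrs_in G w V\<^sub>2"
  have ab: "real a = real d - \<mu> / 2" "real b = \<mu> / 2"
    using n1[OF w] by (simp_all add: a_def b_def)
  have N1: "\<forall>v\<in>V\<^sub>1. nbrs_in G v V\<^sub>1 = a" "\<forall>v\<in>V\<^sub>1. nbrs_in G v V\<^sub>2 = b"
    and N2: "\<forall>v\<in>V\<^sub>2. nbrs_in G v V\<^sub>1 = b" "\<forall>v\<in>V\<^sub>2. nbrs_in G v V\<^sub>2 = a"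
    by (simp_all add: n1 n2 ab flip: of_nat_eq_iff[where 'a = real])
  have "equitable_partition G [V\<^sub>1, V\<^sub>2]"
    unfolding equitable_partition_def
  proof (intro conjI)
    show "distinct [V\<^sub>1, V\<^sub>2]" using V(2) nonempty by auto
    show "partition_on (pverts G) (set [V\<^sub>1, V\<^sub>2])"
      using V nonempty by (auto simp: partition_on_def disjoint_def)
    show "\<forall>i<length [V\<^sub>1, V\<^sub>2]. \<forall>j<length [V\<^sub>1, V\<^sub>2].
        \<exists>v. \<forall>x\<in>[V\<^sub>1, V\<^sub>2] ! i. nbrs_in G x ([V\<^sub>1, V\<^sub>2] ! j) = v"
      using N1 N2 by (auto simp: less_Suc_eq)
  qed
  moreover have "quotient_matrix G [V\<^sub>1, V\<^sub>2] = mat_of_rows_list 2 [[a, b], [b, a]]"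
  proof -
    \<comment> \<open>Uniqueness needs a vertex in \<open>W\<close>: over an empty cell every
      \<open>v\<close> would qualify.\<close>
    have the: "(THE v. \<forall>x\<in>W. nbrs_in G x W' = v) = c"
      if "\<forall>x\<in>W. nbrs_in G x W' = c" "W \<noteq> {}" for W W' c
      using that by (intro the_equality) auto
    show ?thesis
      unfolding quotient_matrix_def mat_of_rows_list_def
      using the[OF N1(1)] the[OF N1(2)] the[OF N2(1)] the[OF N2(2)] nonempty
      by (intro eq_matI) (auto simp: less_Suc_eq numeral_2_eq_2)
  qed
  moreover have "2 * card V\<^sub>1 = card (pverts G)" "2 * card V\<^sub>2 = card (pverts G)"
    using half card by auto
  ultimately show ?thesis
    using ab by blast
qed

end

section \<open>From columns of fourth roots of unity to equitable bipartitions\<close>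

theorem theorem2p3:
  fixes n :: nat
    and H :: "complex mat"
    and G :: "nat pair_pre_digraph"
    and lam :: "nat \<Rightarrow> complex"
  assumes "complex_hadamard n H"
    and "dephased H"
    and "pair_graph G"
    and "pverts G = {0..<n}"
    and "diagonalisable_by G H"
    and "\<forall>j<n. laplacian G *\<^sub>v col H j = lam j \<cdot>\<^sub>v col H j"
  shows "\<exists>d::nat. (\<forall>v\<in>pverts G. out_degree (with_proj G) v = d) \<and>
    (\<forall>k. 0 < k \<and> k < n \<and> (\<forall>i<n. H $$ (i, k) \<in> {1, -1, \<i>, -\<i>}) \<longrightarrow>
      (\<exists>V\<^sub>1 V\<^sub>2. equitable_partition G [V\<^sub>1, V\<^sub>2] \<and>
        real (card V\<^sub>1) = real n / 2 \<and> real (card V\<^sub>2) = real n / 2 \<and>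
        map_mat of_nat (quotient_matrix G [V\<^sub>1, V\<^sub>2]) =
          mat_of_rows_list 2 [[of_nat d - lam k / 2, lam k / 2],
                              [lam k / 2, of_nat d - lam k / 2]]) \<and>
      (\<exists>m::int. even m \<and> lam k = of_int m))"
proof -
  interpret pair_graph G by (fact assms(3))
  have H: "H \<in> carrier_mat n n"
    using assms(1) by (simp add: complex_hadamard_def)
  obtain d where d: "\<forall>v\<in>pverts G. out_degree (with_proj G) v = d"
    using complex_hadamard_diagonalises_imp_regular[OF assms(1,3,4,6)] by blast
  show ?thesis
  proof (intro exI[of _ d] conjI d allI impI)
    fix k
    assume k: "0 < k \<and> k < n \<and> (\<forall>i<n. H $$ (i, k) \<in> {1, -1, \<i>, -\<i>})"
    define h where "h i = H $$ (i, k)" for i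
    \<comment> \<open>For a fourth root of unity one of the two parts is 0 and the other is 1 or -1,
      so the sum is a sign.\<close>
    define z where "z i = Re (h i) + Im (h i)" for i
    have fin: "pair_fin_digraph G" by unfold_locales
    have nbr: "\<And>u. (i, u) \<in> parcs G \<Longrightarrow> u < n" for i
      using in_arcsD2 assms(4) by auto
    have eig: "of_nat d * h i - (\<Sum>u | (i, u) \<in> parcs G. h u) = lam k * h i" if "i < n" for i
    proof -
      have "(laplacian G *\<^sub>v col H k) $ i = (lam k \<cdot>\<^sub>v col H k) $ i"
        using assms(6) k by simp
      moreover have "(\<Sum>u | (i, u) \<in> parcs G. col H k $ u) = (\<Sum>u | (i, u) \<in> parcs G. h u)"
        using nbr H k by (intro sum.cong) (auto simp: h_def)
      ultimately show ?thesis
        using laplacian_mult_vec[OF fin assms(4), of "col H k" i] H k that d assms(4)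
        by (auto simp: h_def)
    qed
    have h: "h i \<in> {1, -1, \<i>, -\<i>}" if "i < n" for i
      using k that by (simp add: h_def)
    \<comment> \<open>A real eigenvalue commutes with taking real and imaginary parts, which
      \<open>zeig\<close> relies on. Vertex 0 supplies the nonzero entry of
      \<open>h\<close>.\<close>
    have "lam k \<in> \<real>"
      using laplacian_eigenvalue_real[of "\<lambda>_. d" h "lam k" 0] eig h[of 0] k assms(4) by auto
    then obtain \<mu> where mu: "lam k = of_real \<mu>"
      by (rule Reals_cases)
    have zeig: "real d * z i - (\<Sum>u | (i, u) \<in> parcs G. z u) = \<mu> * z i" if "i < n" for i
      using arg_cong[OF eig[OF that], of Re] arg_cong[OF eig[OF that], of Im]
      by (simp add: z_def mu sum.distrib algebra_simps)
    \<comment> \<open>Column 0 is all ones by dephasing, so its inner product with column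
      \<open>k\<close> is the plain sum of \<open>h\<close>.\<close>
    have "(\<Sum>i<n. h i) = 0"
      using complex_hadamard_col_inner[OF assms(1), of 0 k] k assms(2) H
      by (simp add: h_def dephased_def)
    then have "(\<Sum>i<n. Re (h i)) = 0" "(\<Sum>i<n. Im (h i)) = 0"
      by (metis Re_sum zero_complex.sel(1), metis Im_sum zero_complex.sel(2))
    then have bal: "(\<Sum>v\<in>pverts G. z v) = 0"
      by (simp add: z_def sum.distrib assms(4) atLeast0LessThan)
    have zpm: "z i = 1 \<or> z i = -1" if "i < n" for i
      using h[OF that] by (auto simp: z_def)
    obtain V\<^sub>1 V\<^sub>2 a b where V: "equitable_partition G [V\<^sub>1, V\<^sub>2]"
        "2 * card V\<^sub>1 = card (pverts G)" "2 * card V\<^sub>2 = card (pverts G)"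
        "quotient_matrix G [V\<^sub>1, V\<^sub>2] = mat_of_rows_list 2 [[a, b], [b, a]]"
      and ab: "real a = real d - \<mu> / 2" "real b = \<mu> / 2"
      using sign_eigenvector_equitable_partition[of d z \<mu>] d zpm zeig bal k assms(4) by auto
    \<comment> \<open>The counts are known as reals, while \<open>lam k\<close> is complex;
      embedding the reals makes the two comparable.\<close>
    have "complex_of_real (real a) = of_nat d - lam k / 2" "complex_of_real (real b) = lam k / 2"
      unfolding ab mu by simp_all
    then have abc: "of_nat a = of_nat d - lam k / 2" "of_nat b = lam k / 2"
      by simp_all
    have "map_mat of_nat (quotient_matrix G [V\<^sub>1, V\<^sub>2]) =
        mat_of_rows_list 2 [[of_nat d - lam k / 2, lam k / 2],
                            [lam k / 2, of_nat d - lam k / 2]]"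
      unfolding V(4) mat_of_rows_list_def
      by (intro eq_matI) (auto simp: less_Suc_eq numeral_2_eq_2 abc)
    moreover have "real (card V\<^sub>1) = real n / 2" "real (card V\<^sub>2) = real n / 2"
      using V(2,3) assms(4) by auto
    ultimately show "\<exists>V\<^sub>1 V\<^sub>2. equitable_partition G [V\<^sub>1, V\<^sub>2] \<and>
        real (card V\<^sub>1) = real n / 2 \<and> real (card V\<^sub>2) = real n / 2 \<and>
        map_mat of_nat (quotient_matrix G [V\<^sub>1, V\<^sub>2]) =
          mat_of_rows_list 2 [[of_nat d - lam k / 2, lam k / 2],
                              [lam k / 2, of_nat d - lam k / 2]]"
      using V(1) by blast
    \<comment> \<open>Evenness: half the eigenvalue is the neighbour count \<open>b\<close>.\<close>
    have "lam k = of_int (2 * int b)"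
      using abc(2) by (simp add: field_simps)
    then show "\<exists>m::int. even m \<and> lam k = of_int m"
      by (intro exI[of _ "2 * int b"]) simp
  qed
qed

end
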